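(* The real Hilbert space $\ell_2$, with its usual norm, admits a unique complex structure up to isometry.
   Context: For a real Banach space $X$, a complex structure on $X$ in the isometric sense is a complex Banach space whose underlying real Banach space (with its norm) is $X$; it is given by an $\mathbb{R}$-linear map $I$ on $X$ with $I^2=-\mathrm{Id}$ such that $\cos\theta\,\mathrm{Id}+\sin\theta\, I$ is an isometry for all $\theta\in\mathbb{R}$, and the corresponding complex space, denoted $X^I$, has multiplication by $i$ given by $I$. Two complex structures $X^I$, $X^J$ are isometric if there is a surjective $\mathbb{C}$-linear isometry from $X^I$ onto $X^J$, equivalently if $J=PIP^{-1}$ for some surjective $\mathbb{R}$-linear isometry $P$ of $X$. Unique up to isometry means that a complex structure exists and any two are isometric. *)

theory Defs
  imports "HOL-Analysis.Analysis"
begin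

typedef ell2 = "{f :: nat \<Rightarrow> real. summable (\<lambda>n. (f n)\<^sup>2)}"
  morphisms ell2_nth Abs_ell2
  by (rule exI[of _ "\<lambda>_. 0"]) simp

setup_lifting type_definition_ell2

lemma ell2_eqI: "(\<And>n. ell2_nth x n = ell2_nth y n) \<Longrightarrow> x = y"
  by (metis ell2_nth_inject ext)

lemma ell2_summable_square: "summable (\<lambda>n. (ell2_nth x n)\<^sup>2)"
  using ell2_nth by blast

lemma summable_square_mult:
  fixes f g :: "nat \<Rightarrow> real"
  assumes "summable (\<lambda>n. (f n)\<^sup>2)" "summable (\<lambda>n. (g n)\<^sup>2)"
  shows "summable (\<lambda>n. f n * g n)"
proof (rule summable_comparison_test')
  show "summable (\<lambda>n. (f n)\<^sup>2 + (g n)\<^sup>2)"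
    using assms by (rule summable_add)
  fix n :: nat
  have "2 * \<bar>f n * g n\<bar> \<le> (f n)\<^sup>2 + (g n)\<^sup>2"
    using sum_squares_bound[of "\<bar>f n\<bar>" "\<bar>g n\<bar>"] by (simp add: abs_mult)
  then show "norm (f n * g n) \<le> (f n)\<^sup>2 + (g n)\<^sup>2"
    by simp
qed

lemma summable_square_add:
  fixes f g :: "nat \<Rightarrow> real"
  assumes "summable (\<lambda>n. (f n)\<^sup>2)" "summable (\<lambda>n. (g n)\<^sup>2)"
  shows "summable (\<lambda>n. (f n + g n)\<^sup>2)"
proof -
  have "summable (\<lambda>n. (f n)\<^sup>2 + (g n)\<^sup>2 + 2 * (f n * g n))"
    by (intro summable_add summable_mult summable_square_mult assms)
  then show ?thesis by (simp add: power2_sum mult.assoc)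
qed

lemma summable_square_scale:
  fixes f :: "nat \<Rightarrow> real"
  assumes "summable (\<lambda>n. (f n)\<^sup>2)"
  shows "summable (\<lambda>n. (c * f n)\<^sup>2)"
  using summable_mult[OF assms, of "c\<^sup>2"] by (simp add: power_mult_distrib)

lemma ell2_summable_mult: "summable (\<lambda>n. ell2_nth x n * ell2_nth y n)"
  by (intro summable_square_mult ell2_summable_square)

instantiation ell2 :: real_vector
begin

lift_definition zero_ell2 :: ell2 is "\<lambda>_. 0" by simp

lift_definition plus_ell2 :: "ell2 \<Rightarrow> ell2 \<Rightarrow> ell2" is "\<lambda>f g n. f n + g n"
  by (rule summable_square_add)

lift_definition uminus_ell2 :: "ell2 \<Rightarrow> ell2" is "\<lambda>f n. - f n" by simp

lift_definition minus_ell2 :: "ell2 \<Rightarrow> ell2 \<Rightarrow> ell2" is "\<lambda>f g n. f n - g n"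
  subgoal for f g using summable_square_add[of f "\<lambda>n. - g n"] by simp
  done

lift_definition scaleR_ell2 :: "real \<Rightarrow> ell2 \<Rightarrow> ell2" is "\<lambda>c f n. c * f n"
  by (rule summable_square_scale)

instance
  by standard (transfer; simp add: algebra_simps)+

end

lemma ell2_nth_zero [simp]: "ell2_nth 0 n = 0"
  by transfer simp

lemma ell2_nth_add [simp]: "ell2_nth (x + y) n = ell2_nth x n + ell2_nth y n"
  by transfer simp

lemma ell2_nth_diff [simp]: "ell2_nth (x - y) n = ell2_nth x n - ell2_nth y n"
  by transfer simp

lemma ell2_nth_scaleR [simp]: "ell2_nth (c *\<^sub>R x) n = c * ell2_nth x n"
  by transfer simp

instantiation ell2 :: real_inner
begin

definition inner_ell2 :: "ell2 \<Rightarrow> ell2 \<Rightarrow> real"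
  where "inner_ell2 x y = (\<Sum>n. ell2_nth x n * ell2_nth y n)"

definition norm_ell2 :: "ell2 \<Rightarrow> real"
  where "norm_ell2 x = sqrt (\<Sum>n. (ell2_nth x n)\<^sup>2)"

definition sgn_ell2 :: "ell2 \<Rightarrow> ell2"
  where "sgn_ell2 x = x /\<^sub>R norm x"

definition dist_ell2 :: "ell2 \<Rightarrow> ell2 \<Rightarrow> real"
  where "dist_ell2 x y = norm (x - y)"

definition uniformity_ell2 :: "(ell2 \<times> ell2) filter"
  where "uniformity_ell2 = (INF e\<in>{0<..}. principal {(x, y). dist x y < e})"

definition open_ell2 :: "ell2 set \<Rightarrow> bool"
  where "open_ell2 U \<longleftrightarrow> (\<forall>x\<in>U. \<forall>\<^sub>F (x', y) in uniformity. x' = x \<longrightarrow> y \<in> U)"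

instance
proof
  fix x y z :: ell2 and r :: real
  show "inner x y = inner y x"
    by (simp add: inner_ell2_def mult.commute)
  show "inner (x + y) z = inner x z + inner y z"
    by (simp add: inner_ell2_def distrib_right suminf_add ell2_summable_mult)
  show "inner (r *\<^sub>R x) y = r * inner x y"
    by (simp add: inner_ell2_def mult.assoc suminf_mult ell2_summable_mult)
  show "0 \<le> inner x x"
    by (simp add: inner_ell2_def suminf_nonneg ell2_summable_mult)
  show "inner x x = 0 \<longleftrightarrow> x = 0"
    using suminf_eq_zero_iff[OF ell2_summable_mult[of x x]]
    by (auto simp: inner_ell2_def intro: ell2_eqI)
  show "norm x = sqrt (inner x x)"
    by (simp add: norm_ell2_def inner_ell2_def power2_eq_square)
qed (simp_all add: sgn_ell2_def dist_ell2_def uniformity_ell2_def open_ell2_def)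

end

lemma ell2_sum_le_norm: "(\<Sum>n<N. (ell2_nth x n)\<^sup>2) \<le> (norm x)\<^sup>2"
  by (simp add: norm_ell2_def suminf_nonneg ell2_summable_square sum_le_suminf)

lemma ell2_nth_le_norm: "\<bar>ell2_nth x n\<bar> \<le> norm x"
proof -
  have "(ell2_nth x n)\<^sup>2 \<le> (\<Sum>k<Suc n. (ell2_nth x k)\<^sup>2)"
    by (simp add: sum_nonneg)
  also have "\<dots> \<le> (norm x)\<^sup>2"
    by (rule ell2_sum_le_norm)
  finally show ?thesis
    by (metis abs_le_square_iff abs_norm_cancel)
qed

lemma ell2_boundI:
  assumes "\<And>N. (\<Sum>n<N. (f n)\<^sup>2) \<le> e\<^sup>2" "0 \<le> e"
  obtains x where "ell2_nth x = f" "norm x \<le> e"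
proof -
  have s: "summable (\<lambda>n. (f n)\<^sup>2)"
    by (rule summableI_nonneg_bounded[where x = "e\<^sup>2"]) (simp_all add: assms)
  then have f: "ell2_nth (Abs_ell2 f) = f"
    by (simp add: Abs_ell2_inverse)
  have "(\<Sum>n. (f n)\<^sup>2) \<le> e\<^sup>2"
    by (rule suminf_le_const[OF s assms(1)])
  then have "norm (Abs_ell2 f) \<le> e"
    using assms(2) by (simp add: norm_ell2_def f real_le_lsqrt suminf_nonneg s)
  with f show ?thesis by (rule that)
qed

instance ell2 :: complete_space
proof
  fix X :: "nat \<Rightarrow> ell2"
  assume C: "Cauchy X"
  have "Cauchy (\<lambda>m. ell2_nth (X m) n)" for n
  proof (rule metric_CauchyI)
    fix e :: real assume "0 < e"
    then obtain M where M: "\<And>m k. m \<ge> M \<Longrightarrow> k \<ge> M \<Longrightarrow> dist (X m) (X k) < e"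
      using metric_CauchyD[OF C] by blast
    have "dist (ell2_nth (X m) n) (ell2_nth (X k) n) < e" if "m \<ge> M" "k \<ge> M" for m k
      using ell2_nth_le_norm[of "X m - X k" n] M[OF that]
      by (simp add: dist_norm)
    then show "\<exists>M. \<forall>m\<ge>M. \<forall>k\<ge>M. dist (ell2_nth (X m) n) (ell2_nth (X k) n) < e"
      by blast
  qed
  then have "\<forall>n. \<exists>l. (\<lambda>m. ell2_nth (X m) n) \<longlonglongrightarrow> l"
    by (simp add: Cauchy_convergent_iff convergent_def)
  then obtain f where f: "\<And>n. (\<lambda>m. ell2_nth (X m) n) \<longlonglongrightarrow> f n"
    by metis
  have key: "\<exists>M. \<forall>m\<ge>M. \<exists>d. ell2_nth d = (\<lambda>n. ell2_nth (X m) n - f n) \<and> norm d \<le> e"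
    if "0 < e" for e
  proof -
    obtain M where M: "\<And>m k. m \<ge> M \<Longrightarrow> k \<ge> M \<Longrightarrow> dist (X m) (X k) < e"
      using metric_CauchyD[OF C \<open>0 < e\<close>] by blast
    have "(\<Sum>n<N. (ell2_nth (X m) n - f n)\<^sup>2) \<le> e\<^sup>2" if "m \<ge> M" for m N
    proof (rule LIMSEQ_le_const2)
      show "(\<lambda>k. \<Sum>n<N. (ell2_nth (X m) n - ell2_nth (X k) n)\<^sup>2)
              \<longlonglongrightarrow> (\<Sum>n<N. (ell2_nth (X m) n - f n)\<^sup>2)"
        by (intro tendsto_intros f)
      have "(\<Sum>n<N. (ell2_nth (X m) n - ell2_nth (X k) n)\<^sup>2) \<le> e\<^sup>2" if "k \<ge> M" for k
      proof -
        have "(norm (X m - X k))\<^sup>2 \<le> e\<^sup>2"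
          using M[OF \<open>m \<ge> M\<close> that] by (intro power_mono) (simp_all add: dist_norm)
        then show ?thesis
          using ell2_sum_le_norm[of "X m - X k" N] by simp
      qed
      then show "\<exists>K. \<forall>k\<ge>K. (\<Sum>n<N. (ell2_nth (X m) n - ell2_nth (X k) n)\<^sup>2) \<le> e\<^sup>2"
        by blast
    qed
    then show ?thesis
      using ell2_boundI \<open>0 < e\<close> by (metis less_imp_le)
  qed
  obtain M d where d: "ell2_nth d = (\<lambda>n. ell2_nth (X M) n - f n)"
    using key[of 1] by auto
  define L where "L = X M - d"
  have L: "ell2_nth L n = f n" for n
    by (simp add: L_def d)
  have "X \<longlonglongrightarrow> L"
  proof (rule metric_LIMSEQ_I)
    fix r :: real assume "0 < r"
    then obtain K where K: "\<forall>m\<ge>K. \<exists>d. ell2_nth d = (\<lambda>n. ell2_nth (X m) n - f n) \<and> norm d \<le> r / 2"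
      using key[of "r / 2"] by auto
    have "dist (X m) L < r" if m: "m \<ge> K" for m
    proof -
      obtain d where d: "ell2_nth d = (\<lambda>n. ell2_nth (X m) n - f n)" "norm d \<le> r / 2"
        using K m by blast
      have "X m - L = d"
        by (rule ell2_eqI) (simp add: d L)
      then show ?thesis
        using d \<open>0 < r\<close> by (simp add: dist_norm)
    qed
    then show "\<exists>K. \<forall>m\<ge>K. dist (X m) L < r"
      by blast
  qed
  then show "convergent X"
    by (rule convergentI)
qed

instance ell2 :: banach ..

definition distance_preserving :: "('a::metric_space \<Rightarrow> 'b::metric_space) \<Rightarrow> bool"
  where "distance_preserving f \<longleftrightarrow> (\<forall>x y. dist (f x) (f y) = dist x y)"

text \<open>
  The rotations below need not be assumed surjective: the one for \<open>- \<theta>\<close> is inverse to the one for \<open>\<theta>\<close>.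
\<close>

definition isometric_complex_structure :: "('a::banach \<Rightarrow> 'a) \<Rightarrow> bool"
  where "isometric_complex_structure I \<longleftrightarrow>
    linear I \<and> (\<forall>x. I (I x) = - x) \<and>
    (\<forall>\<theta>::real. distance_preserving (\<lambda>x. cos \<theta> *\<^sub>R x + sin \<theta> *\<^sub>R I x))"

text \<open>
  The complex space given by \<open>I\<close> has the same vectors, addition and norm as the real space;
  \<open>cscale I\<close> is its scalar multiplication, in which the imaginary unit acts as \<open>I\<close>.
\<close>

definition cscale :: "('a::real_vector \<Rightarrow> 'a) \<Rightarrow> complex \<Rightarrow> 'a \<Rightarrow> 'a"
  where "cscale I z x = Re z *\<^sub>R x + Im z *\<^sub>R I x"

lemma vector_space_cscale:
  assumes "isometric_complex_structure I"
  shows "vector_space (cscale I)"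
proof -
  interpret I: linear I
    using assms by (simp add: isometric_complex_structure_def)
  have II: "I (I x) = - x" for x
    using assms by (simp add: isometric_complex_structure_def)
  show ?thesis
    by standard
      (simp_all add: cscale_def algebra_simps I.add I.scaleR II)
qed

lemma norm_cscale:
  assumes "isometric_complex_structure I"
  shows "norm (cscale I z x) = cmod z * norm x"
proof -
  interpret I: linear I
    using assms by (simp add: isometric_complex_structure_def)
  have *: "norm (cos \<theta> *\<^sub>R x + sin \<theta> *\<^sub>R I x) = norm x" for \<theta>
  proof -
    have "dist (cos \<theta> *\<^sub>R x + sin \<theta> *\<^sub>R I x) (cos \<theta> *\<^sub>R 0 + sin \<theta> *\<^sub>R I 0) = dist x 0"
      using assms unfolding isometric_complex_structure_def distance_preserving_def by blast
    then show ?thesis by (simp add: I.zero)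
  qed
  obtain r t where z: "z = rcis r t" "r = cmod z"
    by (metis rcis_cmod_Arg)
  have "cscale I z x = r *\<^sub>R (cos t *\<^sub>R x + sin t *\<^sub>R I x)"
    by (simp add: cscale_def z(1) scaleR_add_right)
  then show ?thesis
    using * z(2) by simp
qed

definition isometric_structures :: "('a::banach \<Rightarrow> 'a) \<Rightarrow> ('a \<Rightarrow> 'a) \<Rightarrow> bool"
  where "isometric_structures I J \<longleftrightarrow>
    (\<exists>T. Vector_Spaces.linear (cscale I) (cscale J) T \<and> distance_preserving T \<and> surj T)"

definition unique_isometric_complex_structure :: "'a::banach itself \<Rightarrow> bool"
  where "unique_isometric_complex_structure _ \<longleftrightarrow>
    (\<exists>I :: 'a \<Rightarrow> 'a. isometric_complex_structure I) \<and>
    (\<forall>I J :: 'a \<Rightarrow> 'a. isometric_complex_structure I \<longrightarrow> isometric_complex_structure J \<longrightarrow>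
      isometric_structures I J)"

end

theory Submission
  imports Defs
begin

text \<open>
  A complex structure \<open>I\<close> on a real Hilbert space is isometric exactly when it preserves the norm.
  By polarization it then preserves the inner product, and \<open>I\<^sup>2 = -1\<close> makes it skew; so \<open>x\<close> and
  \<open>I x\<close> are always orthogonal, and the orthogonal complement of an \<open>I\<close>-invariant set is
  \<open>I\<close>-invariant.

  Existence is witnessed by \<open>ell2_J\<close>, the rotation by a right angle in each of the planes spanned by
  the unit vectors with numbers \<open>2 n\<close> and \<open>2 n + 1\<close>.

  For uniqueness, every isometric structure \<open>I\<close> is conjugated to \<open>ell2_J\<close> by an isometry
  (\<open>conjugate_to_ell2_J\<close>). The conjugation takes coordinates with respect to a total orthonormal
  sequence \<open>e\<^sub>0, I e\<^sub>0, e\<^sub>1, I e\<^sub>1, \<dots>\<close>, in which \<open>I\<close> is visibly the rotation above. Such a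
  sequence comes from a Gram--Schmidt process for the Hermitian inner product of \<open>I\<close>, carried out
  in real terms (\<open>complex_gram_schmidt\<close>): the vector \<open>e\<^sub>n\<close> is chosen orthogonal to all earlier
  \<open>e\<^sub>k\<close> and \<open>I e\<^sub>k\<close> and such that the span of the sequence absorbs the \<open>n\<close>-th member of a total
  sequence fixed in advance. The coordinates of a vector are square-summable by Bessel's inequality;
  taking them is isometric by totality, and onto because its range is complete and contains all unit vectors
  (\<open>orthonormal_coordinates\<close>).
\<close>

section \<open>Isometric complex structures on Hilbert spaces\<close>

lemma isometric_structure_norm:
  assumes "isometric_complex_structure I"
  shows "norm (I x) = norm x"
  using norm_cscale[OF assms, of \<i> x] by (simp add: cscale_def)

lemma isometric_structure_inner:
  fixes I :: "'a::{real_inner,banach} \<Rightarrow> 'a"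
  assumes "isometric_complex_structure I"
  shows "I x \<bullet> I y = x \<bullet> y"
proof -
  have "linear I"
    using assms by (simp add: isometric_complex_structure_def)
  then show ?thesis
    using isometric_structure_norm[OF assms] orthogonal_transformation[of I]
    by (simp add: orthogonal_transformation_def)
qed

lemma isometric_structure_skew:
  fixes I :: "'a::{real_inner,banach} \<Rightarrow> 'a"
  assumes "isometric_complex_structure I"
  shows "I x \<bullet> y = - (x \<bullet> I y)"
  using isometric_structure_inner[OF assms, of x "I y"] assms
  by (simp add: isometric_complex_structure_def)

text \<open>
  Preserving the norm is enough: the resulting skewness makes \<open>x\<close> and \<open>I x\<close> orthogonal vectors of
  equal length, so Pythagoras computes the norm of \<open>cos \<theta> x + sin \<theta> I x\<close>.
\<close>

lemma isometric_complex_structureI: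
  fixes I :: "'a::{real_inner,banach} \<Rightarrow> 'a"
  assumes lin: "linear I" and sq: "\<And>x. I (I x) = - x" and nrm: "\<And>x. norm (I x) = norm x"
  shows "isometric_complex_structure I"
  unfolding isometric_complex_structure_def distance_preserving_def
proof (intro conjI allI)
  fix \<theta> :: real and x y :: 'a
  interpret I: linear I by (rule lin)
  have inner: "I v \<bullet> I w = v \<bullet> w" for v w
    using lin nrm orthogonal_transformation[of I] by (simp add: orthogonal_transformation_def)
  have orth: "v \<bullet> I v = 0" for v
    using inner[of v "I v"] by (simp add: sq inner_commute)
  have "(norm (cos \<theta> *\<^sub>R v + sin \<theta> *\<^sub>R I v))\<^sup>2 = (norm v)\<^sup>2" for v
  proof -
    have "(norm (cos \<theta> *\<^sub>R v + sin \<theta> *\<^sub>R I v))\<^sup>2 = (cos \<theta> * norm v)\<^sup>2 + (sin \<theta> * norm v)\<^sup>2"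
      by (subst norm_add_Pythagorean) (simp_all add: orthogonal_def orth nrm power_mult_distrib)
    also have "\<dots> = ((cos \<theta>)\<^sup>2 + (sin \<theta>)\<^sup>2) * (norm v)\<^sup>2"
      by (simp only: power_mult_distrib distrib_right)
    finally show ?thesis
      by simp
  qed
  then have rot: "norm (cos \<theta> *\<^sub>R v + sin \<theta> *\<^sub>R I v) = norm v" for v
    by (simp only: power2_eq_iff_nonneg norm_ge_zero)
  have "cos \<theta> *\<^sub>R x + sin \<theta> *\<^sub>R I x - (cos \<theta> *\<^sub>R y + sin \<theta> *\<^sub>R I y)
      = cos \<theta> *\<^sub>R (x - y) + sin \<theta> *\<^sub>R I (x - y)"
    by (simp add: I.diff algebra_simps)
  then show "dist (cos \<theta> *\<^sub>R x + sin \<theta> *\<^sub>R I x) (cos \<theta> *\<^sub>R y + sin \<theta> *\<^sub>R I y) = dist x y"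
    by (simp add: dist_norm rot)
qed (use lin sq in auto)

section \<open>The standard complex structure\<close>

lift_definition ell2_J :: "ell2 \<Rightarrow> ell2"
  is "\<lambda>f n. if even n then - f (Suc n) else f (n - 1)"
proof -
  fix f :: "nat \<Rightarrow> real"
  assume f: "summable (\<lambda>n. (f n)\<^sup>2)"
  have "inj (\<lambda>n. if even n then Suc n else n - 1)"
    by (rule inj_on_inverseI[where g = "\<lambda>n. if even n then Suc n else n - 1"]) auto
  from summable_reindex[OF f this]
  show "summable (\<lambda>n. (if even n then - f (Suc n) else f (n - 1))\<^sup>2)"
    by (rule back_subst[where P = summable]) auto
qed

lemma norm_ell2_J: "norm (ell2_J x) = norm x"
proof -
  let ?s = "\<lambda>n::nat. if even n then Suc n else n - 1"
  let ?f = "\<lambda>n. (ell2_nth x n)\<^sup>2"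
  have inv: "?s (?s n) = n" for n
    by auto
  have "inj ?s"
    by (rule inj_on_inverseI[where g = ?s]) (rule inv)
  moreover have "range ?s = UNIV"
    by (rule surjI[where f = ?s]) (rule inv)
  ultimately have "suminf (?f \<circ> ?s) = suminf ?f"
    by (intro suminf_reindex ell2_summable_square) auto
  moreover have "(\<lambda>n. (ell2_nth (ell2_J x) n)\<^sup>2) = ?f \<circ> ?s"
    by (auto simp: ell2_J.rep_eq)
  ultimately show ?thesis
    by (simp add: norm_ell2_def)
qed

lemma isometric_complex_structure_ell2_J: "isometric_complex_structure ell2_J"
proof (rule isometric_complex_structureI)
  show "linear ell2_J"
    by (rule linearI; rule ell2_eqI) (simp_all add: ell2_J.rep_eq)
  show "ell2_J (ell2_J x) = - x" for x
    by (rule ell2_eqI) (auto simp: ell2_J.rep_eq uminus_ell2.rep_eq)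
qed (rule norm_ell2_J)

section \<open>The Gram--Schmidt process for a complex structure\<close>

lemma residual_orthogonal:
  fixes S :: "'a::real_inner set"
  assumes "finite S" "pairwise orthogonal S" "\<And>s. s \<in> S \<Longrightarrow> norm s = 1" "t \<in> S"
  shows "(v - (\<Sum>s\<in>S. (v \<bullet> s) *\<^sub>R s)) \<bullet> t = 0"
proof -
  have "(\<Sum>s\<in>S. (v \<bullet> s) * (s \<bullet> t)) = (\<Sum>s\<in>S. if s = t then v \<bullet> t else 0)"
    using assms by (intro sum.cong) (auto simp: pairwise_def orthogonal_def dot_square_norm)
  then show ?thesis
    using assms by (simp add: inner_diff_left inner_sum_left)
qed

text \<open>
  The normalized residual of \<open>v\<close> serves unless \<open>v\<close> already lies in the span of \<open>S\<close>. In that case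
  the condition on \<open>v\<close> holds for every \<open>r\<close>, and the normalized residual of any vector outside the
  span serves; this is where infinite dimension enters, and it keeps the process from stopping.
\<close>

lemma orthonormal_extension:
  fixes S :: "'a::real_inner set"
  assumes S: "finite S" "pairwise orthogonal S" "\<And>s. s \<in> S \<Longrightarrow> norm s = 1"
    and proper: "span S \<noteq> UNIV"
  obtains r where "norm r = 1" "\<And>s. s \<in> S \<Longrightarrow> r \<bullet> s = 0" "v \<in> span (insert r S)"
proof -
  have step: "\<exists>r. norm r = 1 \<and> (\<forall>s\<in>S. r \<bullet> s = 0) \<and> w \<in> span (insert r S)"
    if w: "w \<notin> span S" for w
  proof -
    let ?p = "\<Sum>s\<in>S. (w \<bullet> s) *\<^sub>R s"
    let ?r = "(w - ?p) /\<^sub>R norm (w - ?p)"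
    have p: "?p \<in> span S"
      by (intro span_sum span_scale span_base)
    with w have ne: "w - ?p \<noteq> 0"
      by auto
    have "w = norm (w - ?p) *\<^sub>R ?r + ?p"
      using ne by simp
    also have "\<dots> \<in> span (insert ?r S)"
    proof (rule span_add)
      show "norm (w - ?p) *\<^sub>R ?r \<in> span (insert ?r S)"
        by (rule span_scale, rule span_base) simp
      show "?p \<in> span (insert ?r S)"
        using p span_mono[of S "insert ?r S"] by blast
    qed
    finally have "w \<in> span (insert ?r S)" .
    moreover have "norm ?r = 1"
      using ne by simp
    moreover have "\<forall>s\<in>S. ?r \<bullet> s = 0"
      using residual_orthogonal[OF S] by simp
    ultimately show ?thesis
      by blast
  qed
  show ?thesis
  proof (cases "v \<in> span S")
    case True
    obtain w where "w \<notin> span S"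
      using proper by blast
    then obtain r where "norm r = 1" "\<forall>s\<in>S. r \<bullet> s = 0"
      using step by blast
    moreover have "v \<in> span (insert r S)"
      using True span_mono[of S "insert r S"] by blast
    ultimately show ?thesis
      using that by blast
  next
    case False
    then show ?thesis
      using step that by blast
  qed
qed

text \<open>
  Only the new vector \<open>e\<^sub>n\<close> has to be made orthogonal to the earlier pairs: its companion \<open>I e\<^sub>n\<close>
  inherits this by skewness.
\<close>

lemma complex_gram_schmidt:
  fixes I :: "'a::{real_inner,banach} \<Rightarrow> 'a" and d :: "nat \<Rightarrow> 'a"
  assumes I: "isometric_complex_structure I"
    and infdim: "\<And>S::'a set. finite S \<Longrightarrow> span S \<noteq> UNIV"
  obtains e :: "nat \<Rightarrow> 'a" where "\<And>n. norm (e n) = 1"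
    and "\<And>n k. k \<noteq> n \<Longrightarrow> e n \<bullet> e k = 0"
    and "\<And>n k. e n \<bullet> I (e k) = 0"
    and "\<And>n. d n \<in> span (range e \<union> range (\<lambda>k. I (e k)))"
proof -
  have skew: "I x \<bullet> y = - (x \<bullet> I y)" for x y
    by (rule isometric_structure_skew[OF I])
  have inner: "I x \<bullet> I y = x \<bullet> y" for x y
    by (rule isometric_structure_inner[OF I])
  have self: "x \<bullet> I x = 0" for x
    using skew[of x x] by (simp add: inner_commute)
  define pairs where "pairs f n = f ` {..<n} \<union> (\<lambda>k. I (f k)) ` {..<n}" for f and n :: nat
  define P where "P f n r \<longleftrightarrow>
      norm r = 1 \<and> (\<forall>s\<in>pairs f n. r \<bullet> s = 0) \<and> d n \<in> span (insert r (pairs f n))"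
    for f n and r :: 'a
  have "\<exists>e. \<forall>n. P e n (e n)"
  proof (rule dependent_wellorder_choice)
    show "P f n r = P g n r" if "\<And>k. k < n \<Longrightarrow> f k = g k" for r f g n
    proof -
      have "pairs f n = pairs g n"
        unfolding pairs_def using that by (intro arg_cong2[where f = "(\<union>)"] image_cong) auto
      then show ?thesis
        by (simp add: P_def)
    qed
  next
    fix n f
    assume prev: "\<And>k. k < n \<Longrightarrow> P f k (f k)"
    have unit: "norm (f k) = 1" if "k < n" for k
      using prev[OF that] by (simp add: P_def)
    have lower: "f k \<bullet> f j = 0" "f k \<bullet> I (f j) = 0" if "j < k" "k < n" for j k
      using prev[of k] that by (auto simp: P_def pairs_def)
    have ff: "f k \<bullet> f j = 0" if "j < n" "k < n" "j \<noteq> k" for j k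
      using lower[of j k] lower[of k j] that by (cases j k rule: linorder_cases) (auto simp: inner_commute)
    have fI: "f k \<bullet> I (f j) = 0" if "j < n" "k < n" for j k
      using lower[of j k] lower[of k j] that self skew[of "f k" "f j"]
      by (cases j k rule: linorder_cases) (auto simp: inner_commute)
    have "pairwise orthogonal (pairs f n)"
    proof (rule pairwiseI)
      fix x y assume "x \<in> pairs f n" "y \<in> pairs f n" "x \<noteq> y"
      then show "orthogonal x y"
        unfolding pairs_def orthogonal_def
        by (elim UnE imageE) (use ff fI in \<open>auto simp: inner inner_commute[of "I _" "f _"]\<close>)
    qed
    moreover have "norm s = 1" if "s \<in> pairs f n" for s
      using that unit isometric_structure_norm[OF I] by (auto simp: pairs_def)
    moreover have "finite (pairs f n)"
      by (simp add: pairs_def)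
    ultimately show "\<exists>r. P f n r"
      unfolding P_def using orthonormal_extension[OF _ _ _ infdim, of "pairs f n" "d n"] by metis
  qed
  then obtain e where e: "\<And>n. P e n (e n)"
    by blast
  have lower: "e n \<bullet> e k = 0" "e n \<bullet> I (e k) = 0" if "k < n" for n k
    using e[of n] that by (auto simp: P_def pairs_def)
  show ?thesis
  proof
    show "norm (e n) = 1" for n
      using e[of n] by (simp add: P_def)
    show "e n \<bullet> e k = 0" if "k \<noteq> n" for n k
      using lower[of k n] lower[of n k] that by (cases k n rule: linorder_cases) (auto simp: inner_commute)
    show "e n \<bullet> I (e k) = 0" for n k
      using lower[of k n] lower[of n k] self skew[of "e n" "e k"]
      by (cases k n rule: linorder_cases) (auto simp: inner_commute)
    fix n
    have "insert (e n) (pairs e n) \<subseteq> range e \<union> range (\<lambda>k. I (e k))"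
      by (auto simp: pairs_def)
    then show "d n \<in> span (range e \<union> range (\<lambda>k. I (e k)))"
      using e[of n] span_mono unfolding P_def by blast
  qed
qed

section \<open>The unit vectors of the sequence space\<close>

lift_definition ell2_unit :: "nat \<Rightarrow> ell2" is "\<lambda>k n. if n = k then 1 else 0"
  by (rule summable_finite[of "{k}" for k]) auto

lemma inner_ell2_unit: "ell2_unit k \<bullet> x = ell2_nth x k"
proof -
  have "(\<Sum>n. ell2_nth (ell2_unit k) n * ell2_nth x n)
      = (\<Sum>n\<in>{k}. ell2_nth (ell2_unit k) n * ell2_nth x n)"
    by (rule suminf_finite) (auto simp: ell2_unit.rep_eq)
  then show ?thesis
    by (simp add: inner_ell2_def ell2_unit.rep_eq)
qed

lemma span_finite_ell2_neq_UNIV: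
  fixes S :: "ell2 set"
  assumes "finite S"
  shows "span S \<noteq> UNIV"
proof
  assume "span S = UNIV"
  have inner: "ell2_unit j \<bullet> ell2_unit k = (if j = k then 1 else 0)" for j k
    by (simp add: inner_ell2_unit ell2_unit.rep_eq)
  have "inj ell2_unit"
    by (rule injI) (metis inner zero_neq_one)
  moreover have "independent (range ell2_unit)"
  proof (rule pairwise_orthogonal_independent)
    show "pairwise orthogonal (range ell2_unit)"
      by (auto simp: pairwise_def orthogonal_def inner)
    show "0 \<notin> range ell2_unit"
      by (metis imageE inner inner_zero_left zero_neq_one)
  qed
  then have "finite (range ell2_unit)"
    using independent_span_bound[OF assms] \<open>span S = UNIV\<close> by simp
  ultimately show False
    using finite_imageD infinite_UNIV_nat by blast
qed

text \<open>The tails of a square-summable series tend to zero, so truncations converge in norm.\<close>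

lemma closure_span_ell2_unit: "closure (span (range ell2_unit)) = UNIV"
proof -
  have "x \<in> closure (span (range ell2_unit))" for x
  proof -
    define p where "p N = (\<Sum>k<N. ell2_nth x k *\<^sub>R ell2_unit k)" for N
    have nth_p: "ell2_nth (p N) n = (if n < N then ell2_nth x n else 0)" for n N
      by (induction N) (auto simp: p_def ell2_unit.rep_eq less_Suc_eq)
    have "(norm (x - p N))\<^sup>2 = (norm x)\<^sup>2 - (\<Sum>k<N. (ell2_nth x k)\<^sup>2)" for N
    proof -
      have "x \<bullet> p N = (\<Sum>k<N. (ell2_nth x k)\<^sup>2)"
        by (simp add: p_def inner_sum_right inner_commute[of x] inner_ell2_unit power2_eq_square)
      moreover have "p N \<bullet> p N = (\<Sum>k<N. (ell2_nth x k)\<^sup>2)"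
        using nth_p by (subst (1) p_def) (simp add: inner_sum_left inner_ell2_unit power2_eq_square)
      ultimately show ?thesis
        by (simp add: power2_norm_eq_inner inner_diff_left inner_diff_right inner_commute)
    qed
    moreover have "(\<lambda>N. (norm x)\<^sup>2 - (\<Sum>k<N. (ell2_nth x k)\<^sup>2)) \<longlonglongrightarrow> (norm x)\<^sup>2 - (norm x)\<^sup>2"
    proof (intro tendsto_intros)
      have "(norm x)\<^sup>2 = (\<Sum>k. (ell2_nth x k)\<^sup>2)"
        by (simp add: norm_ell2_def suminf_nonneg ell2_summable_square)
      then show "(\<lambda>N. \<Sum>k<N. (ell2_nth x k)\<^sup>2) \<longlonglongrightarrow> (norm x)\<^sup>2"
        using summable_LIMSEQ[OF ell2_summable_square[of x]] by simp
    qed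
    ultimately have "(\<lambda>N. (norm (x - p N))\<^sup>2) \<longlonglongrightarrow> 0"
      by simp
    then have "(\<lambda>N. norm (p N - x)) \<longlonglongrightarrow> 0"
      using tendsto_real_sqrt[of "\<lambda>N. (norm (x - p N))\<^sup>2" 0] by (simp add: norm_minus_commute)
    then have "p \<longlonglongrightarrow> x"
      using LIM_zero_cancel tendsto_norm_zero_iff by blast
    moreover have "p N \<in> span (range ell2_unit)" for N
      unfolding p_def by (intro span_sum span_scale span_base) auto
    ultimately show ?thesis
      unfolding closure_sequential by blast
  qed
  then show ?thesis
    by blast
qed

section \<open>Coordinates with respect to an orthonormal sequence\<close>

lemma bessel_inequality:
  fixes b :: "nat \<Rightarrow> 'a::real_inner"
  assumes b: "\<And>m n. b m \<bullet> b n = (if m = n then 1 else 0)"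
  shows "(\<Sum>n<N. (b n \<bullet> x)\<^sup>2) \<le> (norm x)\<^sup>2"
proof -
  let ?p = "\<Sum>n<N. (b n \<bullet> x) *\<^sub>R b n"
  have "x \<bullet> ?p = (\<Sum>n<N. (b n \<bullet> x)\<^sup>2)"
    by (simp add: inner_sum_right inner_commute[of x] power2_eq_square)
  moreover have "?p \<bullet> ?p = (\<Sum>n<N. (b n \<bullet> x)\<^sup>2)"
    by (simp add: inner_sum_right inner_sum_left b power2_eq_square if_distrib cong: if_cong)
  moreover have "0 \<le> (x - ?p) \<bullet> (x - ?p)"
    by simp
  ultimately show ?thesis
    by (simp add: power2_norm_eq_inner inner_diff_left inner_diff_right inner_commute)
qed

text \<open>
  Parseval's identity is proved in its polarized form: for fixed \<open>y\<close> the vectors \<open>x\<close> with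
  \<open>C x \<bullet> C y = x \<bullet> y\<close> form a closed subspace, which contains the given total sequence.
\<close>

lemma orthonormal_coordinates:
  fixes b :: "nat \<Rightarrow> 'a::{real_inner,banach}"
  assumes b: "\<And>m n. b m \<bullet> b n = (if m = n then 1 else 0)"
    and total: "closure (span (range b)) = UNIV"
  obtains C :: "'a \<Rightarrow> ell2"
  where "\<And>x n. ell2_nth (C x) n = b n \<bullet> x" "linear C" "\<And>x. norm (C x) = norm x" "bij C"
proof -
  have "\<exists>z. (\<forall>n. ell2_nth z n = b n \<bullet> x) \<and> norm z \<le> norm x" for x
  proof -
    obtain z where "ell2_nth z = (\<lambda>n. b n \<bullet> x)" "norm z \<le> norm x"
      by (rule ell2_boundI[OF bessel_inequality[OF b] norm_ge_zero])
    then show ?thesis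
      by (intro exI[of _ z]) simp
  qed
  then have "\<exists>C. \<forall>x. (\<forall>n. ell2_nth (C x) n = b n \<bullet> x) \<and> norm (C x) \<le> norm x"
    by (intro choice allI)
  then obtain C where C: "\<And>x n. ell2_nth (C x) n = b n \<bullet> x" and bound: "\<And>x. norm (C x) \<le> norm x"
    by blast
  have lin: "linear C"
    by (rule linearI; rule ell2_eqI) (simp_all add: C inner_add_right)
  interpret C: bounded_linear C
    by (rule bounded_linear_intro[where K = 1])
      (use bound in \<open>simp_all add: linear_add[OF lin] linear_scale[OF lin]\<close>)
  have Cb: "C (b n) = ell2_unit n" for n
    by (rule ell2_eqI) (simp add: C b ell2_unit.rep_eq)
  have parseval: "C x \<bullet> C y = x \<bullet> y" for x y
  proof -
    have "closed {x. C x \<bullet> C y = x \<bullet> y}"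
      by (intro closed_Collect_eq continuous_intros C.continuous_on)
    moreover have "span (range b) \<subseteq> {x. C x \<bullet> C y = x \<bullet> y}"
    proof (rule span_minimal)
      show "range b \<subseteq> {x. C x \<bullet> C y = x \<bullet> y}"
        by (auto simp: Cb inner_ell2_unit C)
      show "subspace {x. C x \<bullet> C y = x \<bullet> y}"
        by (auto simp: subspace_def inner_add_left C.add C.scaleR C.zero)
    qed
    ultimately show ?thesis
      using closure_minimal total by blast
  qed
  then have norm: "norm (C x) = norm x" for x
    by (simp add: norm_eq_sqrt_inner)
  have "inj C"
    using norm C.zero by (metis (full_types) lin linear_injective_0 norm_eq_zero)
  moreover have "range C = UNIV"
  proof -
    have "complete (range C)"
      using complete_isometric_image[of 1 UNIV C] norm C.bounded_linear_axioms complete_UNIV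
      by simp
    moreover have "span (range ell2_unit) \<subseteq> range C"
    proof (rule span_minimal)
      show "range ell2_unit \<subseteq> range C"
        using Cb by (metis image_subsetI rangeI)
      show "subspace (range C)"
        using linear_subspace_image[OF lin subspace_UNIV] .
    qed
    ultimately show ?thesis
      using closure_minimal complete_imp_closed closure_span_ell2_unit by blast
  qed
  ultimately have "bij C"
    by (simp add: bij_def)
  with C lin norm show ?thesis
    by (rule that)
qed

section \<open>Uniqueness up to isometry\<close>

lemma conjugate_to_ell2_J:
  fixes I :: "ell2 \<Rightarrow> ell2"
  assumes I: "isometric_complex_structure I"
  obtains C :: "ell2 \<Rightarrow> ell2"
  where "linear C" "\<And>x. norm (C x) = norm x" "bij C" "\<And>x. C (I x) = ell2_J (C x)"
proof -
  obtain e :: "nat \<Rightarrow> ell2" where e: "\<And>n. norm (e n) = 1" "\<And>n k. k \<noteq> n \<Longrightarrow> e n \<bullet> e k = 0"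
      "\<And>n k. e n \<bullet> I (e k) = 0"
    and span: "\<And>n. ell2_unit n \<in> span (range e \<union> range (\<lambda>k. I (e k)))"
    using complex_gram_schmidt[OF I span_finite_ell2_neq_UNIV, of ell2_unit] by metis
  have ee: "e n \<bullet> e k = (if n = k then 1 else 0)" for n k
    using e(1) e(2)[of k n] by (simp add: dot_square_norm)
  define b where "b n = (if even n then e (n div 2) else I (e (n div 2)))" for n
  have b: "b m \<bullet> b n = (if m = n then 1 else 0)" for m n
  proof -
    have "m = n \<longleftrightarrow> (even m = even n \<and> m div 2 = n div 2)"
      by (metis bit_eq_rec)
    then show ?thesis
      by (auto simp: b_def ee e(3) isometric_structure_inner[OF I] inner_commute[of "I _" "e _"])
  qed
  have "range e \<union> range (\<lambda>k. I (e k)) \<subseteq> range b"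
  proof -
    have "e k = b (2 * k)" "I (e k) = b (2 * k + 1)" for k
      by (simp_all add: b_def)
    then show ?thesis
      by blast
  qed
  then have "range ell2_unit \<subseteq> span (range b)"
    using span span_mono by blast
  then have "closure (span (range ell2_unit)) \<subseteq> closure (span (range b))"
    by (intro closure_mono span_minimal) auto
  then have "closure (span (range b)) = UNIV"
    using closure_span_ell2_unit by auto
  from orthonormal_coordinates[OF b this]
  obtain C :: "ell2 \<Rightarrow> ell2" where C: "\<And>x n. ell2_nth (C x) n = b n \<bullet> x"
    and "linear C" "\<And>x. norm (C x) = norm x" "bij C"
    by blast
  moreover have "C (I x) = ell2_J (C x)" for x
  proof (rule ell2_eqI)
    fix n
    show "ell2_nth (C (I x)) n = ell2_nth (ell2_J (C x)) n"
    proof (cases "even n")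
      case True
      then show ?thesis
        using isometric_structure_skew[OF I, of "e (n div 2)" x]
        by (simp add: C ell2_J.rep_eq b_def)
    next
      case False
      then have "(n - 1) div 2 = n div 2"
        by (auto elim: oddE)
      with False show ?thesis
        by (simp add: C ell2_J.rep_eq b_def isometric_structure_inner[OF I])
    qed
  qed
  ultimately show ?thesis
    using that by blast
qed

lemma isometric_structures_ell2:
  fixes I J :: "ell2 \<Rightarrow> ell2"
  assumes I: "isometric_complex_structure I" and J: "isometric_complex_structure J"
  shows "isometric_structures I J"
proof -
  obtain C where C: "linear C" "\<And>x. norm (C x) = norm x" "bij C" "\<And>x. C (I x) = ell2_J (C x)"
    using conjugate_to_ell2_J[OF I] by metis
  obtain D where D: "linear D" "\<And>x. norm (D x) = norm x" "bij D" "\<And>x. D (J x) = ell2_J (D x)"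
    using conjugate_to_ell2_J[OF J] by metis
  define T where "T x = inv D (C x)" for x
  have DT: "D (T x) = C x" for x
    using D(3) by (simp add: T_def bij_is_surj surj_f_inv_f)
  have D_eqI: "x = y" if "D x = D y" for x y
    using that D(3) by (simp add: bij_is_inj inj_eq)
  have add: "T (x + y) = T x + T y" for x y
    by (rule D_eqI) (simp add: DT linear_add[OF C(1)] linear_add[OF D(1)])
  have scale: "T (c *\<^sub>R x) = c *\<^sub>R T x" for c x
    by (rule D_eqI) (simp add: DT linear_scale[OF C(1)] linear_scale[OF D(1)])
  have intertwine: "T (I x) = J (T x)" for x
    by (rule D_eqI) (simp add: DT C(4) D(4))
  have "Vector_Spaces.linear (cscale I) (cscale J) T"
    by (simp add: Vector_Spaces.linear_iff vector_space_cscale I J add scale intertwine cscale_def)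
  moreover have "distance_preserving T"
    unfolding distance_preserving_def
  proof (intro allI)
    fix x y
    have "dist (T x) (T y) = norm (D (T x - T y))"
      by (simp add: dist_norm D(2))
    also have "\<dots> = norm (C (x - y))"
      by (simp add: linear_diff[OF C(1)] linear_diff[OF D(1)] DT)
    finally show "dist (T x) (T y) = dist x y"
      by (simp add: dist_norm C(2))
  qed
  moreover have "surj T"
  proof (rule surjI)
    show "T (inv C (D y)) = y" for y
      by (rule D_eqI) (use C(3) in \<open>simp add: DT bij_is_surj surj_f_inv_f\<close>)
  qed
  ultimately show ?thesis
    unfolding isometric_structures_def by blast
qed

theorem proposition20:
  shows "unique_isometric_complex_structure TYPE(ell2)"
  unfolding unique_isometric_complex_structure_def
  using isometric_complex_structure_ell2_J isometric_structures_ell2 by blast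

end
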